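(* Let $\mathbb{K}$ be a field and let $\mathcal{L}_4^1$ be the $4$-dimensional ternary Leibniz algebra over $\mathbb{K}$ with basis $\{e_1,e_2,e_3,e_4\}$ whose only nonzero brackets of basis elements are $$\llbracket e_1,e_1,e_1\rrbracket=\llbracket e_1,e_1,e_3\rrbracket=\llbracket e_1,e_3,e_1\rrbracket=\llbracket e_3,e_1,e_1\rrbracket=\llbracket e_3,e_1,e_3\rrbracket=\llbracket e_3,e_3,e_3\rrbracket=e_2+e_4.$$ Then, with respect to the basis $\{e_1,e_2,e_3,e_4\}$, the quasi-centroid is $$QCent(\mathcal{L}_4^1)=\left\{\begin{pmatrix}a_{11}&0&0&0\\ a_{21}&a_{22}&a_{23}&a_{24}\\ 0&0&a_{11}&0\\ a_{41}&a_{42}&a_{43}&a_{44}\end{pmatrix} : a_{ij}\in\mathbb{K}\right\}.$$ Moreover, a basis of $QCent(\mathcal{L}_4^1)$ is $\{E_{11}+E_{33},E_{21},E_{41},E_{22},E_{42},E_{23},E_{43},E_{24},E_{44}\}$, where $E_{ij}$ is the matrix with $1$ in position $(i,j)$ and $0$ elsewhere.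
   Context: A ternary Leibniz algebra over $\mathbb{K}$ is a $\mathbb{K}$-vector space $\mathcal{L}$ with a trilinear map $\llbracket -,-,-\rrbracket:\mathcal{L}^{\otimes 3}\to\mathcal{L}$ such that $\llbracket \llbracket x,y,z\rrbracket,t,u\rrbracket=\llbracket x,y,\llbracket z,t,u\rrbracket\rrbracket+\llbracket x,\llbracket y,t,u\rrbracket,z\rrbracket+\llbracket\llbracket x,t,u\rrbracket,y,z\rrbracket$ for all $x,y,z,t,u\in\mathcal{L}$. Its quasi-centroid is $$QCent(\mathcal{L})=\{\Phi\in End_{\mathbb{K}}(\mathcal{L}) : \llbracket\Phi(x),y,z\rrbracket=\llbracket x,\Phi(y),z\rrbracket=\llbracket x,y,\Phi(z)\rrbracket\ \ \forall x,y,z\in\mathcal{L}\}.$$ A linear map $\Phi$ is represented by the matrix $(a_{ij})$ with $\Phi(e_i)=\sum_{j}a_{ji}e_j$. *)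

theory Defs
  imports "HOL-Analysis.Analysis"
begin

locale ternary_leibniz_algebra = vector_space smul
  for smul :: "'k::field \<Rightarrow> 'v::ab_group_add \<Rightarrow> 'v" +
  fixes br :: "'v \<Rightarrow> 'v \<Rightarrow> 'v \<Rightarrow> 'v"
  assumes linear_1: "\<And>y z. Vector_Spaces.linear smul smul (\<lambda>x. br x y z)"
    and linear_2: "\<And>x z. Vector_Spaces.linear smul smul (\<lambda>y. br x y z)"
    and linear_3: "\<And>x y. Vector_Spaces.linear smul smul (\<lambda>z. br x y z)"
    and leibniz: "\<And>x y z t u. br (br x y z) t u =
      br x y (br z t u) + br x (br y t u) z + br (br x t u) y z"

definition quasi_centroid ::
    "('k::field \<Rightarrow> 'v::ab_group_add \<Rightarrow> 'v) \<Rightarrow> ('v \<Rightarrow> 'v \<Rightarrow> 'v \<Rightarrow> 'v) \<Rightarrow> ('v \<Rightarrow> 'v) set" where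
  "quasi_centroid smul br = {\<Phi>. Vector_Spaces.linear smul smul \<Phi> \<and>
     (\<forall>x y z. br (\<Phi> x) y z = br x (\<Phi> y) z \<and> br x (\<Phi> y) z = br x y (\<Phi> z))}"

text \<open>The indices of \<open>e\<close> range over the four-element type \<open>4\<close>, whose elements are
  \<open>1, 2, 3, 4\<close> (with \<open>4 = 0\<close>).\<close>

locale algebra_L41 = ternary_leibniz_algebra smul br
  for smul :: "'k::field \<Rightarrow> 'v::ab_group_add \<Rightarrow> 'v"
    and br :: "'v \<Rightarrow> 'v \<Rightarrow> 'v \<Rightarrow> 'v" +
  fixes e :: "4 \<Rightarrow> 'v"
  assumes inj_e: "inj e"
    and independent_e: "independent (range e)"
    and span_e: "span (range e) = UNIV"
    and br_e: "\<And>i j k. br (e i) (e j) (e k) =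
      (if (i, j, k) \<in> {(1,1,1), (1,1,3), (1,3,1), (3,1,1), (3,1,3), (3,3,3)}
       then e 2 + e 4 else 0)"

text \<open>The entry in row \<open>j\<close> and column \<open>i\<close> is the coefficient of \<open>e j\<close> in \<open>\<Phi> (e i)\<close>.\<close>

definition matrix_wrt ::
    "('k::field \<Rightarrow> 'v::ab_group_add \<Rightarrow> 'v) \<Rightarrow> ('n::finite \<Rightarrow> 'v) \<Rightarrow> ('v \<Rightarrow> 'v) \<Rightarrow> 'k^'n^'n" where
  "matrix_wrt smul e \<Phi> = (\<chi> j i. module.representation smul (range e) (\<Phi> (e i)) (e j))"

definition matrix_scale :: "'k::field \<Rightarrow> 'k^'n^'m \<Rightarrow> 'k^'n^'m" where
  "matrix_scale c A = map_matrix (\<lambda>a. c * a) A"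

definition unit_matrix :: "'m::finite \<Rightarrow> 'n::finite \<Rightarrow> 'k::field^'n^'m" where
  "unit_matrix i j = (\<chi> k l. if k = i \<and> l = j then 1 else 0)"

definition is_basis_of ::
    "('k::field \<Rightarrow> 'v::ab_group_add \<Rightarrow> 'v) \<Rightarrow> 'v set \<Rightarrow> 'v set \<Rightarrow> bool" where
  "is_basis_of smul B S \<longleftrightarrow> \<not> module.dependent smul B \<and> module.span smul B = S"

lemma vector_space_matrix_scale:
  "vector_space (matrix_scale :: 'k::field \<Rightarrow> 'k^'n^'m \<Rightarrow> 'k^'n^'m)"
  by unfold_locales (simp_all add: matrix_scale_def vec_eq_iff algebra_simps)

lemma vector_4 [simp]:
  "(vector [x,y,z,w] :: 'a::zero^4) $ 1 = x"
  "(vector [x,y,z,w] :: 'a::zero^4) $ 2 = y"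
  "(vector [x,y,z,w] :: 'a::zero^4) $ 3 = z"
  "(vector [x,y,z,w] :: 'a::zero^4) $ 4 = w"
  unfolding vector_def by simp_all

lemma (in algebra_L41) matrix_wrt_sum:
  "\<Phi> (e i) = (\<Sum>j\<in>UNIV. smul (matrix_wrt smul e \<Phi> $ j $ i) (e j))"
proof -
  have "(\<Sum>b\<in>range e. smul (representation (range e) (\<Phi> (e i)) b) b) = \<Phi> (e i)"
    using independent_e span_e by (intro sum_representation_eq) auto
  then show ?thesis
    by (simp add: matrix_wrt_def sum.reindex[OF inj_e])
qed

text \<open>The bracket table does define a ternary Leibniz algebra on \<open>K\<^sup>4\<close>, over every field.\<close>

lemma algebra_L41_exists:
  "\<exists>br. algebra_L41 ((*s) :: 'k::field \<Rightarrow> 'k^4 \<Rightarrow> 'k^4) br (\<lambda>i. axis i 1)"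
proof -
  define b :: "'k^4 \<Rightarrow> 'k^4 \<Rightarrow> 'k^4 \<Rightarrow> 'k" where
    "b x y z = x$1*y$1*z$1 + x$1*y$1*z$3 + x$1*y$3*z$1 + x$3*y$1*z$1
      + x$3*y$1*z$3 + x$3*y$3*z$3" for x y z
  define br :: "'k^4 \<Rightarrow> 'k^4 \<Rightarrow> 'k^4 \<Rightarrow> 'k^4" where
    "br x y z = b x y z *s (axis 2 1 + axis 4 1)" for x y z
  have "algebra_L41 ((*s) :: 'k \<Rightarrow> 'k^4 \<Rightarrow> 'k^4) br (\<lambda>i. axis i 1)"
  proof unfold_locales
    show "inj (\<lambda>i::4. axis i (1::'k))"
      by (auto simp: inj_def axis_eq_axis)
    have r: "range (\<lambda>i::4. axis i (1::'k)) = cart_basis"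
      by (auto simp: cart_basis_def)
    show "vec.independent (range (\<lambda>i::4. axis i (1::'k)))"
      unfolding r by (rule independent_cart_basis)
    show "vec.span (range (\<lambda>i::4. axis i (1::'k))) = UNIV"
      unfolding r by (rule span_cart_basis)
    show "br (axis i 1) (axis j 1) (axis k 1) =
      (if (i, j, k) \<in> {(1,1,1), (1,1,3), (1,3,1), (3,1,1), (3,1,3), (3,3,3)}
       then axis 2 1 + axis 4 1 else 0)" for i j k
      using exhaust_4[of i] exhaust_4[of j] exhaust_4[of k]
      by (elim disjE) (simp_all add: br_def b_def axis_def)
    show "br (br x y z) t u = br x y (br z t u) + br x (br y t u) z + br (br x t u) y z"
      for x y z t u
      by (simp add: br_def b_def axis_def)
  qed (simp_all add: br_def b_def vec_eq_iff algebra_simps)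
  then show ?thesis by blast
qed

end

theory Submission
  imports Defs
begin

text \<open>
  Every bracket is a multiple of the single vector \<open>w = e 2 + e 4\<close>, so it is described by a scalar
  trilinear form, and that form sees only the coordinates along \<open>e 1\<close> and \<open>e 3\<close>. Hence
  membership of a linear map \<open>\<Phi>\<close> in the quasi-centroid restricts only rows 1 and 3 of its matrix \<open>A\<close>;
  rows 2 and 4 are free. By trilinearity it suffices to test the defining identities on basis vectors,
  where each becomes a linear equation between entries of \<open>A\<close> (\<open>quasi_centroid_iff_entries\<close>).

  The form is nondegenerate on the span of \<open>e 1\<close> and \<open>e 3\<close>. If \<open>i\<close> is 2 or 4, then two of the three
  expressions vanish, so the \<open>e 1\<close> and \<open>e 3\<close> components of \<open>\<Phi> (e i)\<close> pair to zero with everything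
  and therefore vanish. For the remaining \<open>2 \<times> 2\<close> block in rows and columns 1 and 3, the missing
  brackets of \<open>(e 1, e 3, e 3)\<close> and \<open>(e 3, e 3, e 1)\<close> break the symmetry of the form enough to force
  the block to be scalar. Conversely, a scalar block multiplies every bracket by the same scalar,
  in whichever slot \<open>\<Phi>\<close> is applied.

  Every matrix is the matrix of a linear map, so the image of the quasi-centroid is exactly the set
  of matrices satisfying these entry conditions. The nine listed matrices span that set because the
  conditions leave nine free entries, and they are independent because each of them has a nonzero
  entry at a position where all the others vanish.
\<close>

section \<open>Testing the quasi-centroid identities on basis vectors\<close>

lemma (in vector_space) trilinear_eqI:
  assumes "\<And>y z. Vector_Spaces.linear scale scale (\<lambda>x. f x y z)"
    and "\<And>x z. Vector_Spaces.linear scale scale (\<lambda>y. f x y z)"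
    and "\<And>x y. Vector_Spaces.linear scale scale (\<lambda>z. f x y z)"
    and "\<And>y z. Vector_Spaces.linear scale scale (\<lambda>x. g x y z)"
    and "\<And>x z. Vector_Spaces.linear scale scale (\<lambda>y. g x y z)"
    and "\<And>x y. Vector_Spaces.linear scale scale (\<lambda>z. g x y z)"
    and span: "span B = UNIV"
    and eq: "\<And>x y z. x \<in> B \<Longrightarrow> y \<in> B \<Longrightarrow> z \<in> B \<Longrightarrow> f x y z = g x y z"
  shows "f x y z = g x y z"
proof -
  interpret vector_space_pair scale scale
    by unfold_locales
  have 1: "f x y z = g x y z" if "x \<in> B" "y \<in> B" for x y z
    by (rule linear_eq_on[OF assms(3,6), of _ B]) (use that eq span in auto)
  have 2: "f x y z = g x y z" if "x \<in> B" for x y z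
    by (rule linear_eq_on[OF assms(2,5), of _ B]) (use that 1 span in auto)
  show ?thesis
    by (rule linear_eq_on[OF assms(1,4), of _ B]) (use 2 span in auto)
qed

lemma (in ternary_leibniz_algebra) quasi_centroid_iff_on_spanning_set:
  assumes \<Phi>: "Vector_Spaces.linear smul smul \<Phi>" and span: "span B = UNIV"
  shows "\<Phi> \<in> quasi_centroid smul br \<longleftrightarrow>
    (\<forall>x\<in>B. \<forall>y\<in>B. \<forall>z\<in>B. br (\<Phi> x) y z = br x (\<Phi> y) z \<and> br x (\<Phi> y) z = br x y (\<Phi> z))"
    (is "_ \<longleftrightarrow> ?R")
proof
  have c1: "Vector_Spaces.linear smul smul (\<lambda>x. br (\<Phi> x) y z)" for y z
    using Vector_Spaces.linear_compose[OF \<Phi> linear_1] by (simp add: o_def)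
  have c2: "Vector_Spaces.linear smul smul (\<lambda>y. br x (\<Phi> y) z)" for x z
    using Vector_Spaces.linear_compose[OF \<Phi> linear_2] by (simp add: o_def)
  have c3: "Vector_Spaces.linear smul smul (\<lambda>z. br x y (\<Phi> z))" for x y
    using Vector_Spaces.linear_compose[OF \<Phi> linear_3] by (simp add: o_def)
  assume R: ?R
  have "br (\<Phi> x) y z = br x (\<Phi> y) z" for x y z
    by (rule trilinear_eqI[where f = "\<lambda>x y z. br (\<Phi> x) y z" and g = "\<lambda>x y z. br x (\<Phi> y) z",
          OF c1 linear_2 linear_3 linear_1 c2 linear_3 span])
      (use R in blast)
  moreover have "br x (\<Phi> y) z = br x y (\<Phi> z)" for x y z
    by (rule trilinear_eqI[where f = "\<lambda>x y z. br x (\<Phi> y) z" and g = "\<lambda>x y z. br x y (\<Phi> z)",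
          OF linear_1 c2 linear_3 linear_1 linear_2 c3 span])
      (use R in blast)
  ultimately show "\<Phi> \<in> quasi_centroid smul br"
    using \<Phi> by (simp add: quasi_centroid_def)
qed (simp add: quasi_centroid_def)

section \<open>The entry conditions\<close>

definition quasi_centroid_entries :: "'k::field^4^4 \<Rightarrow> bool" where
  "quasi_centroid_entries A \<longleftrightarrow>
    A$1$2 = 0 \<and> A$1$3 = 0 \<and> A$1$4 = 0 \<and>
    A$3$1 = 0 \<and> A$3$2 = 0 \<and> A$3$4 = 0 \<and> A$3$3 = A$1$1"

definition bracket_coeff :: "4 \<Rightarrow> 4 \<Rightarrow> 4 \<Rightarrow> 'k::field" where
  "bracket_coeff i j k =
    (if (i, j, k) \<in> {(1,1,1), (1,1,3), (1,3,1), (3,1,1), (3,1,3), (3,3,3)} then 1 else 0)"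

text \<open>These equations are what the quasi-centroid identities become once the common vector has been
  cancelled from brackets of basis vectors. For \<open>i\<close> equal to 2 or 4, the triples \<open>(i,3,3)\<close> and
  \<open>(i,1,1)\<close> give \<open>A$3$i = 0\<close> and then \<open>A$1$i = 0\<close>. The triple \<open>(1,1,3)\<close> gives \<open>A$3$1 = 0\<close> and
  \<open>A$1$1 = A$1$3 + A$3$3\<close>, and \<open>(3,3,1)\<close> gives \<open>A$1$3 = A$3$1\<close>, which closes the block.\<close>

lemma bracket_coeff_equations_iff:
  fixes A :: "'k::field^4^4"
  shows "(\<forall>i j k.
      A$1$i * bracket_coeff 1 j k + A$3$i * bracket_coeff 3 j k
        = A$1$j * bracket_coeff i 1 k + A$3$j * bracket_coeff i 3 k \<and>
      A$1$j * bracket_coeff i 1 k + A$3$j * bracket_coeff i 3 k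
        = A$1$k * bracket_coeff i j 1 + A$3$k * bracket_coeff i j 3)
    \<longleftrightarrow> quasi_centroid_entries A"
  (is "(\<forall>i j k. ?L i j k) \<longleftrightarrow> _")
proof
  assume L: "\<forall>i j k. ?L i j k"
  have "?L 1 1 3" "?L 3 3 1" "?L 2 3 3" "?L 2 1 1" "?L 4 3 3" "?L 4 1 1"
    using L by blast+
  then show "quasi_centroid_entries A"
    unfolding quasi_centroid_entries_def bracket_coeff_def by simp
next
  assume A: "quasi_centroid_entries A"
  show "\<forall>i j k. ?L i j k"
  proof (intro allI)
    show "?L i j k" for i j k
      using A exhaust_4[of i] exhaust_4[of j] exhaust_4[of k]
      unfolding quasi_centroid_entries_def
      by (elim disjE) (simp_all add: bracket_coeff_def)
  qed
qed

context algebra_L41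
begin

lemma common_bracket_nonzero: "e 2 + e 4 \<noteq> 0"
proof
  assume "e 2 + e 4 = 0"
  then have "representation (range e) (e 2 + e 4) (e 2) = 0"
    by (simp add: representation_zero)
  moreover have "e 4 \<noteq> e 2"
    using inj_e by (simp add: inj_eq)
  ultimately show False
    using independent_e span_e by (simp add: representation_add representation_basis)
qed

lemma br_basis: "br (e i) (e j) (e k) = smul (bracket_coeff i j k) (e 2 + e 4)"
  by (simp add: br_e bracket_coeff_def)

text \<open>Components along \<open>e 2\<close> and \<open>e 4\<close> drop out of the bracket, so in each slot only rows 1 and 3
  of the matrix contribute.\<close>

lemma br_image_basis:
  fixes \<Phi> :: "'v \<Rightarrow> 'v"
  defines "A \<equiv> matrix_wrt smul e \<Phi>"
  shows "br (\<Phi> (e i)) (e j) (e k) =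
      smul (A$1$i * bracket_coeff 1 j k + A$3$i * bracket_coeff 3 j k) (e 2 + e 4)"
    and "br (e i) (\<Phi> (e j)) (e k) =
      smul (A$1$j * bracket_coeff i 1 k + A$3$j * bracket_coeff i 3 k) (e 2 + e 4)"
    and "br (e i) (e j) (\<Phi> (e k)) =
      smul (A$1$k * bracket_coeff i j 1 + A$3$k * bracket_coeff i j 3) (e 2 + e 4)"
proof -
  interpret vector_space_pair smul smul
    by unfold_locales
  have \<Phi>: "\<Phi> (e i) = (\<Sum>l\<in>UNIV. smul (A $ l $ i) (e l))" for i
    unfolding A_def by (rule matrix_wrt_sum)
  have *: "bracket_coeff 2 i j = (0::'k)" "bracket_coeff 4 i j = (0::'k)"
    "bracket_coeff i 2 j = (0::'k)" "bracket_coeff i 4 j = (0::'k)"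
    "bracket_coeff i j 2 = (0::'k)" "bracket_coeff i j 4 = (0::'k)" for i j
    by (simp_all add: bracket_coeff_def)
  show "br (\<Phi> (e i)) (e j) (e k) =
      smul (A$1$i * bracket_coeff 1 j k + A$3$i * bracket_coeff 3 j k) (e 2 + e 4)"
    unfolding \<Phi> sum_4 linear_add[OF linear_1] linear_scale[OF linear_1] br_basis
    by (simp only: *) (simp add: scale_left_distrib)
  show "br (e i) (\<Phi> (e j)) (e k) =
      smul (A$1$j * bracket_coeff i 1 k + A$3$j * bracket_coeff i 3 k) (e 2 + e 4)"
    unfolding \<Phi> sum_4 linear_add[OF linear_2] linear_scale[OF linear_2] br_basis
    by (simp only: *) (simp add: scale_left_distrib)
  show "br (e i) (e j) (\<Phi> (e k)) =
      smul (A$1$k * bracket_coeff i j 1 + A$3$k * bracket_coeff i j 3) (e 2 + e 4)"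
    unfolding \<Phi> sum_4 linear_add[OF linear_3] linear_scale[OF linear_3] br_basis
    by (simp only: *) (simp add: scale_left_distrib)
qed

lemma quasi_centroid_iff_entries:
  assumes "Vector_Spaces.linear smul smul \<Phi>"
  shows "\<Phi> \<in> quasi_centroid smul br \<longleftrightarrow> quasi_centroid_entries (matrix_wrt smul e \<Phi>)"
proof -
  have cancel: "smul a (e 2 + e 4) = smul b (e 2 + e 4) \<longleftrightarrow> a = b" for a b
    using common_bracket_nonzero scale_cancel_right by blast
  show ?thesis
    unfolding quasi_centroid_iff_on_spanning_set[OF assms span_e]
      bracket_coeff_equations_iff[symmetric]
    by (simp only: ball_simps ball_UNIV br_image_basis cancel)
qed

text \<open>Every matrix comes from the linear map that sends each basis vector to the combination given by
  the corresponding column.\<close>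

lemma ex_linear_matrix_wrt:
  "\<exists>\<Phi>. Vector_Spaces.linear smul smul \<Phi> \<and> matrix_wrt smul e \<Phi> = A"
proof -
  interpret vector_space_pair smul smul
    by unfold_locales
  define \<Phi> where
    "\<Phi> = construct (range e) (\<lambda>v. \<Sum>j\<in>UNIV. smul (A $ j $ inv e v) (e j))"
  have \<Phi>: "Vector_Spaces.linear smul smul \<Phi>"
    unfolding \<Phi>_def by (rule linear_construct[OF independent_e])
  have image: "\<Phi> (e i) = (\<Sum>j\<in>UNIV. smul (A $ j $ i) (e j))" for i
    unfolding \<Phi>_def by (simp add: construct_basis[OF independent_e] inv_f_f[OF inj_e])
  have "matrix_wrt smul e \<Phi> $ j $ i = (\<Sum>l\<in>UNIV. A $ l $ i * (if j = l then 1 else 0))" for i j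
    using independent_e span_e
    by (simp add: matrix_wrt_def image representation_sum representation_scale
        representation_basis inj_eq[OF inj_e])
  also have "\<dots> i j = A $ j $ i" for i j
    by (simp add: if_distrib[where f = "(*) a" for a] cong: if_cong)
  finally have "matrix_wrt smul e \<Phi> = A"
    by (simp add: vec_eq_iff)
  with \<Phi> show ?thesis
    by blast
qed

lemma matrix_wrt_quasi_centroid:
  "matrix_wrt smul e ` quasi_centroid smul br = {A. quasi_centroid_entries A}"
proof
  show "matrix_wrt smul e ` quasi_centroid smul br \<subseteq> {A. quasi_centroid_entries A}"
    using quasi_centroid_iff_entries by (auto simp: quasi_centroid_def)
  show "{A. quasi_centroid_entries A} \<subseteq> matrix_wrt smul e ` quasi_centroid smul br"
    using ex_linear_matrix_wrt quasi_centroid_iff_entries by (metis imageI mem_Collect_eq subsetI)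
qed

end

section \<open>The basis of the quasi-centroid\<close>

text \<open>In a vanishing linear combination, the entry at a position private to one of the matrices is a
  nonzero multiple of that matrix's coefficient.\<close>

lemma independent_if_private_positions:
  fixes B :: "('k::field^'n^'m) set"
  assumes fin: "finite B"
    and own: "\<And>V. V \<in> B \<Longrightarrow> \<exists>i j. V$i$j \<noteq> 0 \<and> (\<forall>W\<in>B. W \<noteq> V \<longrightarrow> W$i$j = 0)"
  shows "\<not> module.dependent matrix_scale B"
proof -
  interpret vector_space "matrix_scale :: 'k \<Rightarrow> 'k^'n^'m \<Rightarrow> 'k^'n^'m"
    by (rule vector_space_matrix_scale)
  have "u V = 0" if sum0: "(\<Sum>W\<in>B. matrix_scale (u W) W) = 0" and V: "V \<in> B" for u V
  proof -
    obtain i j where ij: "V$i$j \<noteq> 0" "\<And>W. W \<in> B \<Longrightarrow> W \<noteq> V \<Longrightarrow> W$i$j = 0"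
      using own[OF V] by blast
    have "0 = (\<Sum>W\<in>B. u W * W$i$j)"
      using arg_cong[OF sum0, of "\<lambda>M. M$i$j"] by (simp add: matrix_scale_def)
    also have "\<dots> = (\<Sum>W\<in>{V}. u W * W$i$j)"
      by (rule sum.mono_neutral_right) (use fin V ij in auto)
    finally show ?thesis
      using ij(1) by simp
  qed
  then show ?thesis
    by (auto simp: dependent_finite[OF fin])
qed

lemma basis_quasi_centroid_entries:
  "is_basis_of matrix_scale
    {unit_matrix 1 1 + unit_matrix 3 3, unit_matrix 2 1, unit_matrix 4 1,
     unit_matrix 2 2, unit_matrix 4 2, unit_matrix 2 3, unit_matrix 4 3,
     unit_matrix 2 4, unit_matrix 4 4}
    {A :: 'k::field^4^4. quasi_centroid_entries A}"
    (is "is_basis_of _ ?B ?S")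
proof -
  interpret vector_space "matrix_scale :: 'k \<Rightarrow> 'k^4^4 \<Rightarrow> 'k^4^4"
    by (rule vector_space_matrix_scale)
  let ?own = "\<lambda>V i j. V$i$j \<noteq> 0 \<and> (\<forall>W\<in>?B. W \<noteq> V \<longrightarrow> W$i$j = 0)"
  have "?own (unit_matrix 1 1 + unit_matrix 3 3) 1 1"
    "?own (unit_matrix 2 1) 2 1" "?own (unit_matrix 4 1) 4 1" "?own (unit_matrix 2 2) 2 2"
    "?own (unit_matrix 4 2) 4 2" "?own (unit_matrix 2 3) 2 3" "?own (unit_matrix 4 3) 4 3"
    "?own (unit_matrix 2 4) 2 4" "?own (unit_matrix 4 4) 4 4"
    unfolding ball_simps by (simp_all add: unit_matrix_def)
  then have "\<exists>i j. ?own V i j" if "V \<in> ?B" for V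
    using that unfolding insert_iff empty_iff by blast
  then have "independent ?B"
    by (intro independent_if_private_positions) simp_all
  moreover have "span ?B = ?S"
  proof
    have "subspace ?S"
      by (rule subspaceI) (auto simp: quasi_centroid_entries_def matrix_scale_def)
    moreover have "?B \<subseteq> ?S"
      by (auto simp: quasi_centroid_entries_def unit_matrix_def)
    ultimately show "span ?B \<subseteq> ?S"
      by (rule span_minimal[rotated])
    show "?S \<subseteq> span ?B"
    proof
      fix A :: "'k^4^4"
      assume "A \<in> ?S"
      then have "A = matrix_scale (A$1$1) (unit_matrix 1 1 + unit_matrix 3 3)
        + matrix_scale (A$2$1) (unit_matrix 2 1) + matrix_scale (A$4$1) (unit_matrix 4 1)
        + matrix_scale (A$2$2) (unit_matrix 2 2) + matrix_scale (A$4$2) (unit_matrix 4 2)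
        + matrix_scale (A$2$3) (unit_matrix 2 3) + matrix_scale (A$4$3) (unit_matrix 4 3)
        + matrix_scale (A$2$4) (unit_matrix 2 4) + matrix_scale (A$4$4) (unit_matrix 4 4)"
        by (simp add: quasi_centroid_entries_def vec_eq_iff forall_4 matrix_scale_def
            unit_matrix_def)
      also have "\<dots> \<in> span ?B"
        by (intro span_add span_scale span_base) simp_all
      finally show "A \<in> span ?B" .
    qed
  qed
  ultimately show ?thesis
    by (simp add: is_basis_of_def)
qed

lemma Collect_quasi_centroid_entries:
  "{A :: 'k::field^4^4. quasi_centroid_entries A} =
    {vector [vector [a$1$1, 0,     0,     0    ],
             vector [a$2$1, a$2$2, a$2$3, a$2$4],
             vector [0,     0,     a$1$1, 0    ],
             vector [a$4$1, a$4$2, a$4$3, a$4$4]] | a :: 'k^4^4. True}"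
  (is "?S = {?M a | a. True}")
proof
  have "A = ?M A" if "A \<in> ?S" for A
    using that by (simp add: quasi_centroid_entries_def vec_eq_iff forall_4)
  then show "?S \<subseteq> {?M a | a. True}"
    by blast
  show "{?M a | a. True} \<subseteq> ?S"
    by (auto simp: quasi_centroid_entries_def)
qed

theorem theorem3p7:
  fixes smul :: "'k::field \<Rightarrow> 'v::ab_group_add \<Rightarrow> 'v"
    and br :: "'v \<Rightarrow> 'v \<Rightarrow> 'v \<Rightarrow> 'v"
    and e :: "4 \<Rightarrow> 'v"
  assumes "algebra_L41 smul br e"
  shows "matrix_wrt smul e ` quasi_centroid smul br =
      {vector [vector [a$1$1, 0,     0,     0    ],
               vector [a$2$1, a$2$2, a$2$3, a$2$4],
               vector [0,     0,     a$1$1, 0    ],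
               vector [a$4$1, a$4$2, a$4$3, a$4$4]] | a :: 'k^4^4. True}
    \<and> is_basis_of matrix_scale
      {unit_matrix 1 1 + unit_matrix 3 3, unit_matrix 2 1, unit_matrix 4 1,
       unit_matrix 2 2, unit_matrix 4 2, unit_matrix 2 3, unit_matrix 4 3,
       unit_matrix 2 4, unit_matrix 4 4}
      (matrix_wrt smul e ` quasi_centroid smul br)"
  unfolding algebra_L41.matrix_wrt_quasi_centroid[OF assms]
  using Collect_quasi_centroid_entries basis_quasi_centroid_entries by (rule conjI)

end
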